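(* Let $(P,A,\lambda)$ be a regular marked poset and let $N=|P\setminus A|$. For every admissible decomposition $P\setminus A=U_1\sqcup U_2$, $$f_{N-1}\bigl(\mathcal{CO}_{U_1,U_2}(\lambda)\bigr)=f_{N-1}\bigl(\mathcal O_{P,A}(\lambda)\bigr)+\sum_{q\in U_2\cap\operatorname{St}(P)}w(q).$$ Consequently, for any two admissible decompositions $P\setminus A=U_1\sqcup U_2=U_1'\sqcup U_2'$, $$f_{N-1}\bigl(\mathcal{CO}_{U_1,U_2}(\lambda)\bigr)-f_{N-1}\bigl(\mathcal{CO}_{U_1',U_2'}(\lambda)\bigr)=\sum_{q\in U_2\cap\operatorname{St}(P)}w(q)-\sum_{q\in U_2'\cap\operatorname{St}(P)}w(q).$$
   Context: All posets are finite. A marked poset $(P,A,\lambda)$ consists of a finite poset $P$, a subset $A\subseteq P$ containing all minimal and all maximal elements of $P$, and a marking $\lambda=(\lambda_a)_{a\in A}\in\mathbb R^A$ with $\lambda_a\le\lambda_b$ whenever $a\le b$ in $A$. Write $p\to q$ if $q$ covers $p$ in $P$. Regularity: $(P,A,\lambda)$ is regular if for every cover relation $p\to q$ in $P$ and all $a,b\in A$ with $a\le q$ and $p\le b$, one has $a=b$ or $\lambda_a<\lambda_b$. (In particular there are no cover relations between two elements of $A$, and no cover relation gives a redundant inequality in the marked order polytope.) Admissible decomposition: a partition $P\setminus A=U_1\sqcup U_2$ such that $U_2$ is an order ideal (down-closed subset) of $P\setminus A$ with the induced order. $U_1$ is the order part and $U_2$ the chain part. Marked chain--order polytope: $\mathcal{CO}_{U_1,U_2}(\lambda)\subset\mathbb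 R^{P\setminus A}$ is the set of all $x$ such that, with the convention $x_a=\lambda_a$ for $a\in A$, - $x_p\ge 0$ for all $p\in U_2$; - for every saturated chain $s\to p_1\to\cdots\to p_k\to t$ in $P$ with $k\ge 0$, $s,t\in A\cup U_1$ and $p_1,\dots,p_k\in U_2$, one has $x_{p_1}+\dots+x_{p_k}\le x_t-x_s$ (for $k=0$ this reads $x_s\le x_t$ for $s\to t$). The marked order polytope is $\mathcal O_{P,A}(\lambda)=\mathcal{CO}_{P\setminus A,\varnothing}(\lambda)$, i.e. the set of $x\in\mathbb R^{P\setminus A}$ with $x_p\le x_q$ for all $p\le q$ in $P$ (where $x_a=\lambda_a$ for $a\in A$). These polytopes have dimension $N$, and $f_{N-1}$ denotes the number of facets. For $q\in P\setminus A$, let $|q\to|=\#\{p\in P:q\to p\}$ be the number of elements covering $q$, and let $|\rightsquigarrow q|$ be the number of maximal chains ending in $q$, i.e. saturated chains $a\to p_1\to\cdots\to p_k\to q$ with $k\ge 0$, $a\in A$ and $p_1,\dots,p_k\in P\setminus A$. An element $q\in P\setminus A$ is a star element if $|q\to|\ge 2$ and $|\rightsquigarrow q|\ge 2$; $\operatorname{St}(P)$ denotes the set of star elements, and for $q\in\operatorname{St}(P)$, $$w(q)=(|q\to|-1)(|\rightsquigarrow q|-1).$$ *)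

theory Defs
  imports "HOL-Analysis.Analysis"
begin

text \<open>
  A poset is a carrier \<open>P\<close> inside an order type, with the induced order. Hence the cover
  relation is taken relative to \<open>P\<close>, not to the ambient type.
\<close>

definition covers :: "'p::order set \<Rightarrow> 'p \<Rightarrow> 'p \<Rightarrow> bool" where
  "covers P p q \<longleftrightarrow> p \<in> P \<and> q \<in> P \<and> p < q \<and> \<not> (\<exists>r\<in>P. p < r \<and> r < q)"

definition marked_poset :: "'p::order set \<Rightarrow> 'p set \<Rightarrow> ('p \<Rightarrow> real) \<Rightarrow> bool" where
  "marked_poset P A lam \<longleftrightarrow>
     finite P \<and> A \<subseteq> P \<and>
     (\<forall>p\<in>P. (\<forall>r\<in>P. \<not> r < p) \<longrightarrow> p \<in> A) \<and>
     (\<forall>p\<in>P. (\<forall>r\<in>P. \<not> p < r) \<longrightarrow> p \<in> A) \<and>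
     (\<forall>a\<in>A. \<forall>b\<in>A. a \<le> b \<longrightarrow> lam a \<le> lam b)"

definition regular_marking :: "'p::order set \<Rightarrow> 'p set \<Rightarrow> ('p \<Rightarrow> real) \<Rightarrow> bool" where
  "regular_marking P A lam \<longleftrightarrow>
     (\<forall>p q. covers P p q \<longrightarrow>
        (\<forall>a\<in>A. \<forall>b\<in>A. a \<le> q \<and> p \<le> b \<longrightarrow> a = b \<or> lam a < lam b))"

definition admissible_decomposition :: "'p::order set \<Rightarrow> 'p set \<Rightarrow> 'p set \<Rightarrow> 'p set \<Rightarrow> bool" where
  "admissible_decomposition P A U1 U2 \<longleftrightarrow>
     U1 \<union> U2 = P - A \<and> U1 \<inter> U2 = {} \<and>
     (\<forall>q\<in>U2. \<forall>p\<in>P - A. p \<le> q \<longrightarrow> p \<in> U2)"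

text \<open>
  The space \<open>\<real>\<^bsup>P - A\<^esup>\<close> is realised as the coordinate subspace of
  \<open>real ^ 'p\<close> on which all coordinates outside \<open>P - A\<close> vanish. The convention
  \<open>x\<^sub>a = \<lambda>\<^sub>a\<close> for marked \<open>a\<close> is expressed by \<open>marked_coord\<close>.
\<close>

definition unmarked_space :: "'p::finite set \<Rightarrow> 'p set \<Rightarrow> (real ^ 'p) set" where
  "unmarked_space P A = {x. \<forall>p. p \<notin> P - A \<longrightarrow> x $ p = 0}"

definition marked_coord :: "'p::finite set \<Rightarrow> ('p \<Rightarrow> real) \<Rightarrow> real ^ 'p \<Rightarrow> 'p \<Rightarrow> real" where
  "marked_coord A lam x p = (if p \<in> A then lam p else x $ p)"

definition chain_order_polytope ::
    "'p::{finite,order} set \<Rightarrow> 'p set \<Rightarrow> ('p \<Rightarrow> real) \<Rightarrow> 'p set \<Rightarrow> 'p set \<Rightarrow> (real ^ 'p::{finite,order}) set" where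
  "chain_order_polytope P A lam U1 U2 =
     {x \<in> unmarked_space P A.
        (\<forall>p\<in>U2. 0 \<le> x $ p) \<and>
        (\<forall>s t ps. s \<in> A \<union> U1 \<and> t \<in> A \<union> U1 \<and> set ps \<subseteq> U2 \<and>
             successively (covers P) (s # ps @ [t]) \<longrightarrow>
           (\<Sum>p\<leftarrow>ps. x $ p) \<le> marked_coord A lam x t - marked_coord A lam x s)}"

definition order_polytope ::
    "'p::{finite,order} set \<Rightarrow> 'p set \<Rightarrow> ('p \<Rightarrow> real) \<Rightarrow> (real ^ 'p::{finite,order}) set" where
  "order_polytope P A lam = chain_order_polytope P A lam (P - A) {}"

lemma covers_imp_le:
  fixes f :: "'p::order \<Rightarrow> real"
  assumes "finite P" and cov: "\<And>p q. covers P p q \<Longrightarrow> f p \<le> f q"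
    and "p \<in> P" "q \<in> P" "p \<le> q"
  shows "f p \<le> f q"
  using assms(3-5)
proof (induction "card {r \<in> P. p < r \<and> r < q}" arbitrary: p q rule: less_induct)
  case less
  show ?case
  proof (cases "p = q \<or> covers P p q")
    case True
    then show ?thesis using cov by auto
  next
    case False
    then obtain r where r: "r \<in> P" "p < r" "r < q"
      using less.prems by (auto simp: covers_def order.order_iff_strict)
    have "{u \<in> P. p < u \<and> u < r} \<subset> {u \<in> P. p < u \<and> u < q}"
      "{u \<in> P. r < u \<and> u < q} \<subset> {u \<in> P. p < u \<and> u < q}"
      using r by (auto dest: order.strict_trans)
    then have "card {u \<in> P. p < u \<and> u < r} < card {u \<in> P. p < u \<and> u < q}"
      "card {u \<in> P. r < u \<and> u < q} < card {u \<in> P. p < u \<and> u < q}"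
      using \<open>finite P\<close> by (auto intro!: psubset_card_mono)
    then have "f p \<le> f r" "f r \<le> f q"
      using less.hyps[of p r] less.hyps[of r q] less.prems r by auto
    then show ?thesis by simp
  qed
qed

lemma order_polytope_altdef:
  assumes "A \<subseteq> P"
  shows "order_polytope P A lam =
    {x \<in> unmarked_space P A.
       \<forall>p\<in>P. \<forall>q\<in>P. p \<le> q \<longrightarrow> marked_coord A lam x p \<le> marked_coord A lam x q}"
proof -
  have "(\<forall>s t. s \<in> P \<and> t \<in> P \<and> covers P s t \<longrightarrow> f s \<le> f t) \<longleftrightarrow>
      (\<forall>p\<in>P. \<forall>q\<in>P. p \<le> q \<longrightarrow> f p \<le> f q)" for f :: "'a \<Rightarrow> real"
    using covers_imp_le[of P f] by (auto simp: covers_def)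
  moreover have "A \<union> (P - A) = P" using assms by auto
  ultimately show ?thesis
    by (simp add: order_polytope_def chain_order_polytope_def)
qed

text \<open>\<open>f\<^sub>k\<close>, the number of \<open>k\<close>-dimensional faces (the empty face has dimension \<open>-1\<close>).\<close>

definition face_number :: "int \<Rightarrow> 'a::euclidean_space set \<Rightarrow> nat" where
  "face_number k Q = card {F. F face_of Q \<and> aff_dim F = k}"

lemma face_number_eq_card_facets:
  assumes "aff_dim Q = int N" "0 < N"
  shows "face_number (int N - 1) Q = card {F. F facet_of Q}"
proof -
  have "{F. F face_of Q \<and> aff_dim F = int N - 1} = {F. F facet_of Q}"
    using assms by (auto simp: facet_of_def)
  then show ?thesis by (simp add: face_number_def)
qed

definition num_covering :: "'p::order set \<Rightarrow> 'p \<Rightarrow> nat" where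
  "num_covering P q = card {p \<in> P. covers P q p}"

definition num_chains_to :: "'p::order set \<Rightarrow> 'p set \<Rightarrow> 'p \<Rightarrow> nat" where
  "num_chains_to P A q =
     card {(a, ps). a \<in> A \<and> set ps \<subseteq> P - A \<and> successively (covers P) (a # ps @ [q])}"

definition star_elements :: "'p::order set \<Rightarrow> 'p set \<Rightarrow> 'p set" where
  "star_elements P A = {q \<in> P - A. 2 \<le> num_covering P q \<and> 2 \<le> num_chains_to P A q}"

definition star_weight :: "'p::order set \<Rightarrow> 'p set \<Rightarrow> 'p \<Rightarrow> nat" where
  "star_weight P A q = (num_covering P q - 1) * (num_chains_to P A q - 1)"

end

theory Submission imports Defs begin

text \<open>
  Every inequality in the definition of the chain-order polytope is a facet, so its facets are
  counted by \<open>U2\<close> together with the chains. For irredundancy, start from a potential \<open>y\<close> on \<open>P\<close>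
  extending \<open>lam\<close> and subtract from \<open>y p\<close>, for \<open>p\<close> in \<open>U2\<close>, the largest value of \<open>y\<close> on the elements
  covered by \<open>p\<close>. A chain inequality then is tight iff at each step the chain passes through a maximiser
  and the last cover is an equality of \<open>y\<close>. Regularity provides a \<open>y\<close> for which only the given
  chain has this property. Since \<open>U2\<close> is an ideal, the chains are paths from \<open>A\<close> through \<open>U2\<close>;
  double counting their prolongations by one cover relation compares them with the cover relations,
  which are the facets of the order polytope.
\<close>

section \<open>Facets of an irredundant polyhedron\<close>

text \<open>A tight point \<open>w\<close>, moved slightly away from \<open>z\<close>, violates
  inequality \<open>i\<close> alone; this irredundancy makes each halfspace cut out a facet. The
  same \<open>w\<close> tells facet \<open>i\<close> from all others, so facets can be counted by
  indices.\<close>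

lemma
  fixes V :: "'a::euclidean_space set" and c :: "'i \<Rightarrow> 'a" and d :: "'i \<Rightarrow> real"
  assumes "affine V" "finite I" "z \<in> V"
    and z: "\<And>i. i \<in> I \<Longrightarrow> c i \<bullet> z < d i"
    and tight: "\<And>i. i \<in> I \<Longrightarrow> \<exists>w\<in>V. c i \<bullet> w = d i \<and> (\<forall>j\<in>I - {i}. c j \<bullet> w < d j)"
    and S_eq: "S = {x \<in> V. \<forall>i\<in>I. c i \<bullet> x \<le> d i}"
  shows aff_dim_irredundant_halfspaces: "aff_dim S = aff_dim V"
    and card_facets_irredundant_halfspaces: "card {F. F facet_of S} = card I"
proof -
  define h where "h i = {x. c i \<bullet> x \<le> d i}" for i
  define T where "T = {x. \<forall>i\<in>I. c i \<bullet> x < d i}"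
  have "open T"
  proof -
    have "T = (\<Inter>i\<in>I. {x. c i \<bullet> x < d i})" by (auto simp: T_def)
    then show ?thesis using \<open>finite I\<close> by (auto intro: open_halfspace_lt)
  qed
  moreover have "z \<in> V \<inter> T" using assms by (auto simp: T_def)
  ultimately have "affine hull (V \<inter> T) = V"
    using affine_hull_affine_Int_open[OF \<open>affine V\<close>] \<open>affine V\<close>
    by (metis affine_hull_eq empty_iff)
  moreover have "V \<inter> T \<subseteq> S" "S \<subseteq> V" by (auto simp: S_eq T_def less_imp_le)
  ultimately have hull: "affine hull S = V"
    using \<open>affine V\<close> by (metis hull_minimal hull_mono subset_antisym)
  then show "aff_dim S = aff_dim V" by (metis aff_dim_affine_hull)
  have violate: "\<exists>v\<in>V. v \<notin> h i \<and> (\<forall>j\<in>I - {i}. v \<in> h j)" if i: "i \<in> I" for i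
  proof -
    obtain w where w: "w \<in> V" "c i \<bullet> w = d i" "\<forall>j\<in>I - {i}. c j \<bullet> w < d j"
      using tight[OF i] by auto
    have "\<forall>\<^sub>F e in at_right 0. \<forall>j\<in>I - {i}. c j \<bullet> (w + e *\<^sub>R (w - z)) < d j"
    proof (rule eventually_ball_finite, use \<open>finite I\<close> in simp, intro ballI)
      fix j assume j: "j \<in> I - {i}"
      have "((\<lambda>e. c j \<bullet> (w + e *\<^sub>R (w - z))) \<longlongrightarrow> c j \<bullet> (w + 0 *\<^sub>R (w - z))) (at_right 0)"
        by (intro tendsto_intros)
      then show "\<forall>\<^sub>F e in at_right 0. c j \<bullet> (w + e *\<^sub>R (w - z)) < d j"
        using w(3) j by (intro order_tendstoD) auto
    qed
    then obtain e where e: "e > 0" "\<forall>j\<in>I - {i}. c j \<bullet> (w + e *\<^sub>R (w - z)) < d j"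
      using eventually_happens'[OF _ eventually_conj[OF eventually_at_right_less]]
      by (metis (mono_tags, lifting) trivial_limit_at_right_real)
    have "w + e *\<^sub>R (w - z) = (1 + e) *\<^sub>R w + (- e) *\<^sub>R z" by (simp add: algebra_simps)
    then have "w + e *\<^sub>R (w - z) \<in> V"
      using mem_affine[OF \<open>affine V\<close> w(1) \<open>z \<in> V\<close>, of "1 + e" "- e"] by simp
    moreover have "c i \<bullet> (w + e *\<^sub>R (w - z)) > d i"
      using z[OF i] e(1) w(2) by (simp add: inner_add_right inner_diff_right)
    ultimately show ?thesis using e(2) unfolding h_def
      by (intro bexI[of _ "w + e *\<^sub>R (w - z)"]) (auto intro: less_imp_le)
  qed
  have inj: "inj_on h I"
  proof (rule inj_onI, rule ccontr)
    fix i j assume "i \<in> I" "j \<in> I" "h i = h j" "i \<noteq> j"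
    then show False using violate[of i] by auto
  qed
  \<comment> \<open>\<open>facet_of_polyhedron_explicit\<close> attaches normals and bounds to
    halfspaces rather than to indices; \<open>g\<close> recovers the index.\<close>
  define g where "g = inv_into I h"
  have g: "g (h i) = i" if "i \<in> I" for i using inj that by (simp add: g_def)
  have facet_iff: "F facet_of S \<longleftrightarrow> (\<exists>H. H \<in> h ` I \<and> F = S \<inter> {x. c (g H) \<bullet> x = d (g H)})" for F
  proof (rule facet_of_polyhedron_explicit)
    show "finite (h ` I)" using \<open>finite I\<close> by simp
    show "S = affine hull S \<inter> \<Inter> (h ` I)" unfolding hull by (auto simp: S_eq h_def)
    show "c (g H) \<noteq> 0 \<and> H = {x. c (g H) \<bullet> x \<le> d (g H)}" if H: "H \<in> h ` I" for H
    proof -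
      obtain i where i: "i \<in> I" "H = h i" using H by auto
      then have "c i \<noteq> 0" using z[of i] tight[of i] by auto
      then show ?thesis using i g by (simp add: h_def)
    qed
    show "S \<subset> affine hull S \<inter> \<Inter> F'" if F': "F' \<subset> h ` I" for F'
    proof -
      obtain i where i: "i \<in> I" "h i \<notin> F'" using F' by auto
      obtain v where "v \<in> V" "v \<notin> h i" "\<forall>j\<in>I - {i}. v \<in> h j" using violate[OF i(1)] by auto
      moreover have "S \<subseteq> affine hull S \<inter> \<Inter> F'"
        using F' unfolding hull by (fastforce simp: S_eq h_def)
      ultimately show ?thesis using i F' unfolding hull by (fastforce simp: S_eq h_def)
    qed
  qed
  define f where "f i = S \<inter> {x. c i \<bullet> x = d i}" for i
  have "{F. F facet_of S} = f ` I"
    unfolding facet_iff f_def using g by auto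
  moreover have "inj_on f I"
  proof (rule inj_onI, rule ccontr)
    fix i j assume ij: "i \<in> I" "j \<in> I" "f i = f j" "i \<noteq> j"
    obtain w where w: "w \<in> V" "c i \<bullet> w = d i" "\<forall>k\<in>I - {i}. c k \<bullet> w < d k"
      using tight[OF ij(1)] by auto
    then have "w \<in> f i" unfolding f_def S_eq by (auto simp: less_imp_le) (metis DiffI less_eq_real_def singletonD)
    moreover have "c j \<bullet> w < d j" using w(3) ij(2,4) by auto
    then have "w \<notin> f j" by (simp add: f_def)
    ultimately show False using ij by simp
  qed
  ultimately show "card {F. F facet_of S} = card I" by (simp add: card_image)
qed

lemma aff_dim_unmarked_space: "aff_dim (unmarked_space P A) = int (card (P - A))"
proof -
  have "subspace (unmarked_space P A)"
    by (auto simp: unmarked_space_def subspace_def)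
  moreover have "dim (unmarked_space P A) = card (P - A)"
    unfolding unmarked_space_def
    using dim_substandard_cart[where 'a=real, of "P - A"]
    by (simp only: dim_vec_eq)
  ultimately show ?thesis by (simp add: aff_dim_subspace)
qed

section \<open>Potentials on a regular marked poset\<close>

locale regular_marked_poset =
  fixes P A :: "'p::{finite,order} set" and lam :: "'p \<Rightarrow> real"
  assumes marked: "marked_poset P A lam" and regular: "regular_marking P A lam"
begin

lemma marked_subset: "A \<subseteq> P"
  using marked by (simp add: marked_poset_def)

lemma ex_marked_above:
  assumes "p \<in> P" shows "\<exists>b\<in>A. p \<le> b"
proof -
  obtain m where "m \<in> P" "p \<le> m" "\<forall>b\<in>P. m \<le> b \<longrightarrow> m = b"
    using finite_has_maximal2[of P p] assms by auto
  then show ?thesis using marked unfolding marked_poset_def by (metis order.strict_iff_not order.refl)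
qed

lemma ex_marked_below:
  assumes "p \<in> P" shows "\<exists>a\<in>A. a \<le> p"
proof -
  obtain m where "m \<in> P" "m \<le> p" "\<forall>b\<in>P. b \<le> m \<longrightarrow> m = b"
    using finite_has_minimal2[of P p] assms by auto
  then show ?thesis using marked unfolding marked_poset_def by (metis order.strict_iff_not order.refl)
qed

lemma covers_lam_less:
  assumes "covers P p q" "a \<in> A" "b \<in> A" "a \<le> q" "p \<le> b" "a \<noteq> b"
  shows "lam a < lam b"
  using regular assms unfolding regular_marking_def by blast

lemma ex_cover_below:
  assumes "p \<in> P" "q \<in> P" "p < q" shows "\<exists>r. covers P r q \<and> p \<le> r"
proof -
  obtain r where "r \<in> {r \<in> P. p \<le> r \<and> r < q}" "\<forall>b\<in>{r \<in> P. p \<le> r \<and> r < q}. r \<le> b \<longrightarrow> r = b"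
    using finite_has_maximal2[of "{r \<in> P. p \<le> r \<and> r < q}" p] assms by auto
  then show ?thesis using assms unfolding covers_def
    by (intro exI[of _ r]) (fastforce dest: order.strict_trans1)
qed

text \<open>Regularity applies to a cover relation into \<open>b\<close> whose lower end lies above
  \<open>a\<close>: there \<open>a\<close> is below the upper end and \<open>b\<close> above the
  lower end.\<close>

lemma lam_strict:
  assumes "a \<in> A" "b \<in> A" "a < b" shows "lam a < lam b"
proof -
  obtain r where "covers P r b" "a \<le> r" using ex_cover_below[of a b] assms marked_subset by blast
  then have "covers P r b" "r \<le> b" by (auto simp: covers_def)
  show ?thesis
  proof (cases "r \<in> A")
    case True
    then have "lam b < lam r" using covers_lam_less[OF \<open>covers P r b\<close>, of b r] assms
        \<open>covers P r b\<close> by (auto simp: covers_def)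
    moreover have "lam r \<le> lam b"
      using marked True assms \<open>r \<le> b\<close> by (auto simp: marked_poset_def)
    ultimately show ?thesis by simp
  next
    case False
    show ?thesis
      using covers_lam_less[OF \<open>covers P r b\<close>, of a b] assms \<open>r \<le> b\<close> by auto
  qed
qed

text \<open>Regularity with \<open>q\<close> as the mark below \<open>q\<close> and \<open>p\<close>
  as the mark above \<open>p\<close> would give \<open>lam q < lam p\<close>.\<close>

lemma covers_not_both_marked:
  assumes "covers P p q" "p \<in> A" shows "q \<notin> A"
proof
  assume "q \<in> A"
  then have "lam q < lam p" "lam p < lam q"
    using covers_lam_less[OF assms(1), of q p] lam_strict[of p q] assms by (auto simp: covers_def)
  then show False by simp
qed

text \<open>The gap is the scale from which all later perturbations of potentials are cut.\<close>

lemma ex_lam_gap: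
  obtains g :: real where "g > 0" "\<And>a b. a \<in> A \<Longrightarrow> b \<in> A \<Longrightarrow> lam a < lam b \<Longrightarrow> lam a + g \<le> lam b"
proof -
  define D where "D = {lam b - lam a | a b. a \<in> A \<and> b \<in> A \<and> lam a < lam b}"
  have "D = (\<lambda>(a, b). lam b - lam a) ` {(a, b). a \<in> A \<and> b \<in> A \<and> lam a < lam b}"
    by (auto simp: D_def)
  then have "finite D" by simp
  moreover have "\<forall>x\<in>D. 0 < x" by (auto simp: D_def)
  ultimately have *: "0 < Min (insert 1 D)" by simp
  show ?thesis
  proof (rule that[OF *])
    fix a b assume "a \<in> A" "b \<in> A" "lam a < lam b"
    then have "Min (insert 1 D) \<le> lam b - lam a"
      using \<open>finite D\<close> by (intro Min_le) (auto simp: D_def)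
    then show "lam a + Min (insert 1 D) \<le> lam b" by simp
  qed
qed

section \<open>Potentials extending the marking\<close>

definition height :: "'p \<Rightarrow> real" where
  "height p = real (card {u. u < p})"

lemma height_strict: "p < q \<Longrightarrow> height p < height q"
  unfolding height_def
  by (intro of_nat_less_iff[THEN iffD2] psubset_card_mono) (auto dest: order.strict_trans)

lemma height_nonneg: "0 \<le> height p"
  by (simp add: height_def)

lemma height_le: "height p + 1 \<le> real CARD('p)"
proof -
  have "card {u. u < p} < CARD('p)" by (intro psubset_card_mono) auto
  then show ?thesis unfolding height_def by linarith
qed

definition upper :: "'p \<Rightarrow> real" where
  "upper p = Min (lam ` {b \<in> A. p \<le> b})"

lemma upper_le: "b \<in> A \<Longrightarrow> p \<le> b \<Longrightarrow> upper p \<le> lam b"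
  unfolding upper_def by (intro Min_le) auto

lemma le_upper: "p \<in> P \<Longrightarrow> (\<And>b. b \<in> A \<Longrightarrow> p \<le> b \<Longrightarrow> x \<le> lam b) \<Longrightarrow> x \<le> upper p"
  unfolding upper_def using ex_marked_above[of p] by (subst Min_ge_iff) auto

lemma upper_mono: "p \<le> q \<Longrightarrow> q \<in> P \<Longrightarrow> upper p \<le> upper q"
  by (intro le_upper) (auto intro: upper_le)

text \<open>
  Outside the up-set of \<open>C\<close> the potential is kept close to its least possible value, while elements of \<open>C\<close> are raised
  close to \<open>upper\<close>, their largest possible value. Regularity, applied to the cover \<open>q < q'\<close>, says that no
  mark below \<open>q'\<close> reaches \<open>upper q\<close>.
\<close>

lemma ex_separating_potential:
  assumes "C \<subseteq> P" and chain: "\<And>u v. u \<in> C \<Longrightarrow> v \<in> C \<Longrightarrow> u \<le> v \<or> v \<le> u"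
  obtains y where "\<And>a. a \<in> A \<Longrightarrow> y a = lam a"
    and "\<And>p q. p \<in> P \<Longrightarrow> q \<in> P \<Longrightarrow> p < q \<Longrightarrow> y p < y q"
    and "\<And>q q' r. q \<in> C \<Longrightarrow> covers P q q' \<Longrightarrow> covers P r q' \<Longrightarrow> r \<noteq> q \<Longrightarrow> y r < y q"
proof -
  obtain g where g: "g > 0" "\<And>a b. a \<in> A \<Longrightarrow> b \<in> A \<Longrightarrow> lam a < lam b \<Longrightarrow> lam a + g \<le> lam b"
    using ex_lam_gap by blast
  define R where "R = real CARD('p)"
  have R: "0 \<le> height p" "height p + 1 \<le> R" for p unfolding R_def by (auto simp: height_nonneg height_le)
  have "1 \<le> R" using R[of undefined] by simp
  \<comment> \<open>Two nested scales: \<open>R + 2\<close> steps of size \<open>e\<close> fit into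
    the gap \<open>g\<close>, and the tie-breaker \<open>d * height p\<close> stays below a single
    step \<open>e\<close>.\<close>
  define e where "e = g / (R + 2)"
  define d where "d = e / (R + 1)"
  have e: "e > 0" "e * (R + 2) = g" using g(1) \<open>1 \<le> R\<close> by (auto simp: e_def)
  have d: "d > 0" "d * (R + 1) = e" using e(1) \<open>1 \<le> R\<close> by (auto simp: d_def)
  have dr: "0 \<le> d * height p" "d * height p < e" for p
  proof -
    show "0 \<le> d * height p" using d R by simp
    have "d * height p \<le> d * R" using d R(2)[of p] by (intro mult_left_mono) auto
    then show "d * height p < e" using d unfolding distrib_left by linarith
  qed
  \<comment> \<open>The raised value of \<open>u\<close> lies between \<open>e\<close> and
    \<open>e * R\<close> below \<open>upper u\<close> and, as \<open>upper\<close> is monotone,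
    grows by at least \<open>e\<close> with each step up the chain.\<close>
  define m where "m u = upper u - e * (R - height u)" for u
  \<comment> \<open>The lower bounds imposed on \<open>y p\<close>. At an unmarked \<open>p\<close>,
    \<open>y p\<close> is the largest of them plus the tie-breaker.\<close>
  define sd where "sd p = lam ` {a \<in> A. a \<le> p} \<union> m ` {u \<in> C. u \<le> p}" for p
  define y where "y p = (if p \<in> A then lam p else Max (sd p) + d * height p)" for p
  have fin: "finite (sd p)" for p by (simp add: sd_def)
  have ne: "sd p \<noteq> {}" if "p \<in> P" for p using ex_marked_below[OF that] by (auto simp: sd_def)
  have sd_ge: "s \<le> Max (sd p)" if "s \<in> sd p" for s p using fin that by simp
  have m_upper: "m u + e \<le> upper u" for u
    using e(1) R[of u] mult_left_mono[of 1 "R - height u" e] by (simp add: m_def)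
  have m_ge: "upper u - e * R \<le> m u" for u
    using e(1) R[of u] mult_left_mono[of "R - height u" R e] by (simp add: m_def)
  have eR: "e * R + e < g" using e by (simp add: algebra_simps)
  then have "e < g" using e(1) \<open>1 \<le> R\<close> by (smt (verit) mult_nonneg_nonneg)
  have below_mark: "y p < lam b" if "p \<in> P" "b \<in> A" "p < b" for p b
  proof (cases "p \<in> A")
    case True
    then show ?thesis using lam_strict that by (simp add: y_def)
  next
    case False
    have "s + e \<le> lam b" if "s \<in> sd p" for s
      using that unfolding sd_def
    proof (elim UnE imageE)
      fix a assume "s = lam a" "a \<in> {a \<in> A. a \<le> p}"
      then show ?thesis using g(2)[of a b] lam_strict[of a b] \<open>p < b\<close> \<open>b \<in> A\<close> \<open>e < g\<close> by force
    next
      fix u assume "s = m u" "u \<in> {u \<in> C. u \<le> p}"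
      then show ?thesis using m_upper[of u] upper_le[of b u] \<open>p < b\<close> \<open>b \<in> A\<close> by force
    qed
    then have "Max (sd p) \<le> lam b - e"
      using fin ne[OF \<open>p \<in> P\<close>] by (subst Max_le_iff) (auto simp: algebra_simps)
    then show ?thesis using False dr(2)[of p] by (simp add: y_def)
  qed
  have strict: "y p < y q" if "p \<in> P" "q \<in> P" "p < q" for p q
  proof (cases "q \<in> A")
    case True
    then show ?thesis using below_mark[of p q] that by (simp add: y_def)
  next
    case q: False
    have *: "d * height p < d * height q" using height_strict[OF that(3)] d(1) by simp
    show ?thesis
    proof (cases "p \<in> A")
      case True
      then have "lam p \<le> Max (sd q)" using that by (intro sd_ge) (auto simp: sd_def)
      then show ?thesis using True q * dr(1)[of p] by (simp add: y_def)
    next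
      case False
      have "Max (sd p) \<le> Max (sd q)"
        using that ne fin by (intro Max_mono) (auto simp: sd_def)
      then show ?thesis using False q * by (simp add: y_def)
    qed
  qed
  show ?thesis
  proof
    show "y a = lam a" if "a \<in> A" for a using that by (simp add: y_def)
    show "y p < y q" if "p \<in> P" "q \<in> P" "p < q" for p q using strict that .
    fix q q' r assume q: "q \<in> C" and q': "covers P q q'" and r: "covers P r q'" and "r \<noteq> q"
    have P: "q \<in> P" "r \<in> P" "q' \<in> P" "r < q'" "q < q'" using q' r by (auto simp: covers_def)
    have "\<not> q \<le> r" using q' P \<open>r \<noteq> q\<close> by (auto simp: covers_def)
    have mq: "m q \<le> y q"
    proof (cases "q \<in> A")
      case True
      then show ?thesis using m_upper[of q] upper_le[of q q] e(1) by (simp add: y_def)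
    next
      case False
      have "m q \<le> Max (sd q)" using q by (intro sd_ge) (auto simp: sd_def)
      then show ?thesis using dr(1)[of q] False by (simp add: y_def)
    qed
    \<comment> \<open>All bounds entering \<open>y r\<close> are compared with \<open>m q\<close>. A
      mark below \<open>r\<close> is also below \<open>q'\<close>, so regularity keeps it a full gap
      \<open>g\<close> under every mark above \<open>q\<close>.\<close>
    have a: "lam a + e < m q" if "a \<in> A" "a \<le> r" for a
    proof -
      have "lam a + g \<le> upper q"
      proof (rule le_upper[OF P(1)])
        fix b assume b: "b \<in> A" "q \<le> b"
        have "a \<noteq> b" using that b \<open>\<not> q \<le> r\<close> by auto
        then show "lam a + g \<le> lam b"
          using covers_lam_less[OF q' that(1) b(1)] that b P g(2) by auto
      qed
      then show ?thesis using m_ge[of q] eR by linarith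
    qed
    \<comment> \<open>An element of \<open>C\<close> below \<open>r\<close> is strictly below
      \<open>q\<close>; otherwise \<open>q\<close> would be below \<open>r\<close>, although
      \<open>q'\<close> covers both.\<close>
    have u: "m u + e \<le> m q" if "u \<in> C" "u \<le> r" for u
    proof -
      have "\<not> q < u" using that \<open>\<not> q \<le> r\<close> by auto
      then have "u < q" using chain[OF q that(1)] that \<open>\<not> q \<le> r\<close> by (auto simp: order.order_iff_strict)
      moreover have "height u + 1 \<le> height q" using height_strict[OF \<open>u < q\<close>] by (simp add: height_def)
      ultimately show ?thesis
        using upper_mono[OF less_imp_le[OF \<open>u < q\<close>] P(1)] mult_left_mono[of "height u + 1" "height q" e] e(1)
        by (simp add: m_def algebra_simps)
    qed
    have "y r < m q"
    proof (cases "r \<in> A")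
      case True
      then show ?thesis using a[of r] e(1) by (simp add: y_def)
    next
      case False
      have "Max (sd r) \<le> m q - e"
        using fin ne[OF P(2)] a u by (subst Max_le_iff) (auto simp: sd_def algebra_simps less_imp_le)
      then show ?thesis using False dr(2)[of r] by (simp add: y_def)
    qed
    then show "y r < y q" using mq by simp
  qed
qed

text \<open>This serves the facet of the chain inequality formed by \<open>C\<close> and the final
  cover into \<open>t\<close>: that cover becomes the only equality, while elements of
  \<open>C\<close> still beat their rivals below a common cover.\<close>

lemma ex_tight_potential:
  assumes "C \<subseteq> P" and chain: "\<And>u v. u \<in> C \<Longrightarrow> v \<in> C \<Longrightarrow> u \<le> v \<or> v \<le> u"
    and q0: "q0 \<in> C" "\<And>u. u \<in> C \<Longrightarrow> u \<le> q0" and t: "covers P q0 t"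
  obtains y where "\<And>a. a \<in> A \<Longrightarrow> y a = lam a"
    and "\<And>p q. covers P p q \<Longrightarrow> (p, q) \<noteq> (q0, t) \<Longrightarrow> y p < y q"
    and "y q0 = y t"
    and "\<And>q q' r. q \<in> C \<Longrightarrow> covers P q q' \<Longrightarrow> q' \<noteq> t \<Longrightarrow> covers P r q' \<Longrightarrow> r \<noteq> q \<Longrightarrow> y r < y q"
proof -
  obtain y where y: "\<And>a. a \<in> A \<Longrightarrow> y a = lam a"
    "\<And>p q. p \<in> P \<Longrightarrow> q \<in> P \<Longrightarrow> p < q \<Longrightarrow> y p < y q"
    and sep: "\<And>q q' r. q \<in> C \<Longrightarrow> covers P q q' \<Longrightarrow> covers P r q' \<Longrightarrow> r \<noteq> q \<Longrightarrow> y r < y q"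
    using ex_separating_potential[OF assms(1) chain] by blast
  have strict: "y p < y q" if "covers P p q" for p q
    using y(2) that by (auto simp: covers_def)
  have q0t: "q0 \<in> P" "t \<in> P" "q0 < t" using t by (auto simp: covers_def)
  have "t \<notin> C" using q0 q0t by force
  \<comment> \<open>Reach equality by lowering \<open>t\<close>, or, if \<open>t\<close> is marked, by raising all of the up-set of \<open>q0\<close>.\<close>
  show ?thesis
  proof (cases "t \<in> A")
    case False
    show ?thesis
    proof (rule that[of "y(t := y q0)"])
      show "(y(t := y q0)) a = lam a" if "a \<in> A" for a using that False y by auto
      show "(y(t := y q0)) p < (y(t := y q0)) q" if "covers P p q" "(p, q) \<noteq> (q0, t)" for p q
      proof -
        have "p \<noteq> q" using that by (auto simp: covers_def)
        \<comment> \<open>Lowering \<open>t\<close> endangers only covers into \<open>t\<close>;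
          there \<open>sep\<close> places every other lower cover of \<open>t\<close> strictly under
          \<open>y q0\<close>.\<close>
        consider "p = t" "q \<noteq> t" | "p \<noteq> t" "q = t" | "p \<noteq> t" "q \<noteq> t" using \<open>p \<noteq> q\<close> by auto
        then show ?thesis
          using strict[OF that(1)] strict[OF t] sep[OF q0(1) t, of p] that by cases auto
      qed
      show "(y(t := y q0)) q0 = (y(t := y q0)) t" by simp
      show "(y(t := y q0)) r < (y(t := y q0)) q"
        if "q \<in> C" "covers P q q'" "covers P r q'" "r \<noteq> q" for q q' r
        using sep[OF that] sep[OF that(1,2), of t] strict[OF t] that \<open>t \<notin> C\<close> by (cases "r = t") auto
    qed
  next
    case True
    obtain g where g: "g > 0" "\<And>a b. a \<in> A \<Longrightarrow> b \<in> A \<Longrightarrow> lam a < lam b \<Longrightarrow> lam a + g \<le> lam b"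
      using ex_lam_gap by blast
    define e where "e = g / real CARD('p)"
    have "e > 0" using g by (simp add: e_def)
    have height_bound: "e * (height q - height q0) < g" for q
    proof -
      have "e * (height q - height q0) < e * real CARD('p)"
        using height_le[of q] height_nonneg[of q0] \<open>e > 0\<close> by simp
      then show ?thesis by (simp add: e_def)
    qed
    \<comment> \<open>The floor \<open>l\<close> equals \<open>lam t\<close> at \<open>q0\<close>
      and rises by less than \<open>g\<close> in total. By regularity every other mark above
      \<open>q0\<close> is at least \<open>lam t + g\<close>, so it is never reached.\<close>
    define l where "l q = lam t + e * (height q - height q0)" for q
    define y' where "y' q = (if q \<notin> A \<and> q0 \<le> q then max (y q) (l q) else y q)" for q
    have "q0 \<notin> A" using covers_not_both_marked[OF t] True by auto
    have y'q0: "y' q0 = lam t"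
      using \<open>q0 \<notin> A\<close> strict[OF t] y(1)[OF True] by (simp add: y'_def l_def)
    have l_less: "l q < lam b" if "q0 \<le> q" "q \<le> b" "b \<in> A" "b \<noteq> t" for q b
      using covers_lam_less[OF t True that(3)] that g(2)[OF True that(3)] height_bound[of q]
      by (auto simp: l_def)
    show ?thesis
    proof (rule that[of y'])
      show "y' a = lam a" if "a \<in> A" for a using that y by (simp add: y'_def)
      show "y' p < y' q" if cov: "covers P p q" and ne: "(p, q) \<noteq> (q0, t)" for p q
      proof -
        have pq: "p \<in> P" "q \<in> P" "p < q" using cov by (auto simp: covers_def)
        show ?thesis
        proof (cases "p \<notin> A \<and> q0 \<le> p")
          case p: True
          show ?thesis
          proof (cases "q \<in> A")
            case True
            \<comment> \<open>Nothing lies strictly between \<open>q0\<close> and \<open>t\<close>,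
              so no other cover into \<open>t\<close> starts in the raised up-set.\<close>
            have "q \<noteq> t"
            proof
              assume "q = t"
              then have "q0 < p" using p ne by auto
              then show False using t pq \<open>q = t\<close> by (auto simp: covers_def)
            qed
            then have "l p < y q" using l_less[of p q] p pq True y(1) by auto
            then show ?thesis using p True strict[OF cov] by (simp add: y'_def)
          next
            case False
            have "l p < l q" using height_strict[OF pq(3)] \<open>e > 0\<close> by (simp add: l_def)
            moreover have "q0 \<le> q" using p pq by auto
            ultimately show ?thesis using p False strict[OF cov] by (auto simp: y'_def)
          qed
        next
          case False
          then have "y' p = y p" by (auto simp: y'_def)
          then show ?thesis using strict[OF cov] by (auto simp: y'_def)
        qed
      qed
      show "y' q0 = y' t" using y'q0 True y by (simp add: y'_def)
      show "y' r < y' q" if "q \<in> C" "covers P q q'" "covers P r q'" "r \<noteq> q" for q q' r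
      proof -
        \<comment> \<open>The rival \<open>r\<close> is not raised: above \<open>q0\<close> it would
          lie above \<open>q\<close>, although both are covered by \<open>q'\<close>.\<close>
        have "\<not> q0 \<le> r"
        proof
          assume "q0 \<le> r"
          then have "q < r" using q0(2)[OF that(1)] that(4) by auto
          then show False using that(2,3) by (auto simp: covers_def)
        qed
        then show ?thesis using sep[OF that] by (auto simp: y'_def)
      qed
    qed
  qed
qed

end

section \<open>Facets of the chain-order polytope\<close>

lemma successively_covers_sorted:
  assumes "successively (covers P) xs" shows "sorted_wrt (<) xs"
proof -
  have "successively (<) xs"
    by (rule successively_mono[OF assms]) (simp add: covers_def)
  then show ?thesis by (simp add: successively_conv_sorted_wrt[OF transp_on_less])
qed

lemma sorted_wrt_less_total:
  fixes xs :: "'p::order list"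
  assumes "sorted_wrt (<) xs" "u \<in> set xs" "v \<in> set xs"
  shows "u \<le> v \<or> v \<le> u"
  using assms by (induction xs) auto

lemma sorted_wrt_less_le_last:
  fixes xs :: "'p::order list"
  assumes "sorted_wrt (<) xs" "u \<in> set xs"
  shows "u \<le> last xs"
  using assms by (induction xs) (auto intro: less_imp_le)

lemma sorted_wrt_less_distinct: "sorted_wrt (<) (xs :: 'p::order list) \<Longrightarrow> distinct xs"
  by (induction xs) auto

locale decomposed_marked_poset = regular_marked_poset P A lam
  for P A :: "'p::{finite,order} set" and lam :: "'p \<Rightarrow> real" +
  fixes U1 U2 :: "'p set"
  assumes decomposition: "admissible_decomposition P A U1 U2"
begin

lemma U_eq: "U1 \<union> U2 = P - A" and U_disjoint: "U1 \<inter> U2 = {}"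
  using decomposition by (auto simp: admissible_decomposition_def)

lemma U_subset: "U1 \<subseteq> P - A" "U2 \<subseteq> P - A"
  using U_eq by auto

lemma U2_not_outer: "p \<in> U2 \<Longrightarrow> p \<notin> A \<union> U1"
  using U_subset U_disjoint by auto

lemma U2_ideal: "q \<in> U2 \<Longrightarrow> p \<in> P - A \<Longrightarrow> p \<le> q \<Longrightarrow> p \<in> U2"
  using decomposition by (auto simp: admissible_decomposition_def)

lemma ex_covered: "p \<in> P - A \<Longrightarrow> \<exists>r. covers P r p"
  using ex_marked_below[of p] ex_cover_below[of _ p] marked_subset
  by (metis DiffD1 DiffD2 order.not_eq_order_implies_strict subsetD)

section \<open>The defining inequalities as halfspaces\<close>

definition chains :: "('p \<times> 'p list \<times> 'p) set" where
  "chains = {(s, ps, t). s \<in> A \<union> U1 \<and> t \<in> A \<union> U1 \<and> set ps \<subseteq> U2 \<and>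
     successively (covers P) (s # ps @ [t])}"

lemma finite_chains: "finite chains"
proof (rule finite_subset)
  show "chains \<subseteq> UNIV \<times> {ps. set ps \<subseteq> UNIV \<and> distinct ps} \<times> UNIV"
  proof (rule subrelI)
    fix s pt assume "(s, pt) \<in> chains"
    moreover obtain ps t where pt: "pt = (ps, t)" by (cases pt)
    ultimately have "sorted_wrt (<) (s # ps @ [t])"
      by (intro successively_covers_sorted) (auto simp: chains_def)
    then have "sorted_wrt (<) ps" by (simp add: sorted_wrt_append)
    then show "(s, pt) \<in> UNIV \<times> {ps. set ps \<subseteq> UNIV \<and> distinct ps} \<times> UNIV"
      unfolding pt by (simp add: sorted_wrt_less_distinct)
  qed
  show "finite ((UNIV :: 'p set) \<times> {ps :: 'p list. set ps \<subseteq> UNIV \<and> distinct ps} \<times> (UNIV :: 'p set))"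
    by (intro finite_cartesian_product finite_subset_distinct) auto
qed

text \<open>Together with \<open>offset\<close>, this splits \<open>marked_coord\<close> into linear
  and constant part as an affine function of the point.\<close>

definition coord :: "'p \<Rightarrow> real ^ 'p::{finite,order}" where
  "coord p = (if p \<in> A then 0 else axis p 1)"

definition offset :: "'p \<Rightarrow> real" where
  "offset p = (if p \<in> A then lam p else 0)"

lemma marked_coord_eq: "marked_coord A lam x p = coord p \<bullet> x + offset p"
  by (simp add: marked_coord_def coord_def offset_def inner_axis')

text \<open>Index \<open>Inl p\<close> encodes nonnegativity at \<open>p\<close>, \<open>Inr\<close>
  a chain inequality, both in the form \<open>normal i \<bullet> x \<le> bound i\<close>.\<close>

fun normal :: "'p + 'p \<times> 'p list \<times> 'p \<Rightarrow> real ^ 'p::{finite,order}" where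
  "normal (Inl p) = - axis p 1"
| "normal (Inr (s, ps, t)) = (\<Sum>p\<leftarrow>ps. axis p 1) + coord s - coord t"

fun bound :: "'p + 'p \<times> 'p list \<times> 'p \<Rightarrow> real" where
  "bound (Inl p) = 0"
| "bound (Inr (s, ps, t)) = offset t - offset s"

lemma normal_minus_bound:
  "normal (Inl p) \<bullet> x - bound (Inl p) = - (x $ p)"
  "normal (Inr (s, ps, t)) \<bullet> x - bound (Inr (s, ps, t)) =
     (\<Sum>p\<leftarrow>ps. x $ p) - (marked_coord A lam x t - marked_coord A lam x s)"
proof -
  show "normal (Inl p) \<bullet> x - bound (Inl p) = - (x $ p)" by (simp add: inner_axis')
  have "(\<Sum>p\<leftarrow>ps. axis p 1) \<bullet> x = (\<Sum>p\<leftarrow>ps. x $ p)"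
    by (induction ps) (auto simp: inner_axis' inner_add_left)
  then show "normal (Inr (s, ps, t)) \<bullet> x - bound (Inr (s, ps, t)) =
     (\<Sum>p\<leftarrow>ps. x $ p) - (marked_coord A lam x t - marked_coord A lam x s)"
    by (simp add: marked_coord_eq inner_add_left inner_diff_left)
qed

lemma satisfies_iff:
  "normal (Inl p) \<bullet> x \<le> bound (Inl p) \<longleftrightarrow> 0 \<le> x $ p"
  "normal (Inl p) \<bullet> x < bound (Inl p) \<longleftrightarrow> 0 < x $ p"
  "normal (Inl p) \<bullet> x = bound (Inl p) \<longleftrightarrow> x $ p = 0"
  "normal (Inr (s, ps, t)) \<bullet> x \<le> bound (Inr (s, ps, t)) \<longleftrightarrow>
     (\<Sum>p\<leftarrow>ps. x $ p) \<le> marked_coord A lam x t - marked_coord A lam x s"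
  "normal (Inr (s, ps, t)) \<bullet> x < bound (Inr (s, ps, t)) \<longleftrightarrow>
     (\<Sum>p\<leftarrow>ps. x $ p) < marked_coord A lam x t - marked_coord A lam x s"
  "normal (Inr (s, ps, t)) \<bullet> x = bound (Inr (s, ps, t)) \<longleftrightarrow>
     (\<Sum>p\<leftarrow>ps. x $ p) = marked_coord A lam x t - marked_coord A lam x s"
  using normal_minus_bound(1)[of p x] normal_minus_bound(2)[of s ps t x] by linarith+

lemma chain_order_polytope_eq:
  "chain_order_polytope P A lam U1 U2 =
     {x \<in> unmarked_space P A. \<forall>i\<in>U2 <+> chains. normal i \<bullet> x \<le> bound i}"
proof -
  have "(\<forall>i\<in>U2 <+> chains. Q i) \<longleftrightarrow> (\<forall>p\<in>U2. Q (Inl p)) \<and>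
      (\<forall>s t ps. (s, ps, t) \<in> chains \<longrightarrow> Q (Inr (s, ps, t)))" for Q
    by auto
  then show ?thesis
    unfolding chain_order_polytope_def by (simp only: satisfies_iff) (simp add: chains_def)
qed

section \<open>The transfer map\<close>

definition max_below :: "('p \<Rightarrow> real) \<Rightarrow> 'p \<Rightarrow> real" where
  "max_below y p = Max (y ` {r. covers P r p})"

lemma max_below_ge: "covers P r p \<Longrightarrow> y r \<le> max_below y p"
  unfolding max_below_def by (intro Max_ge) auto

lemma max_below_less:
  "p \<in> P - A \<Longrightarrow> (\<And>r. covers P r p \<Longrightarrow> y r < c) \<Longrightarrow> max_below y p < c"
  unfolding max_below_def using ex_covered[of p] by (subst Max_less_iff) auto

lemma max_below_eq:
  "covers P q p \<Longrightarrow> (\<And>r. covers P r p \<Longrightarrow> r \<noteq> q \<Longrightarrow> y r < y q) \<Longrightarrow> max_below y p = y q"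
  unfolding max_below_def by (intro Max_eqI) (auto simp: less_imp_le, metis less_eq_real_def)

text \<open>Stanley's transfer map from order to chain polytopes, applied on \<open>U2\<close>
  only.\<close>

definition transfer :: "('p \<Rightarrow> real) \<Rightarrow> real ^ 'p::{finite,order}" where
  "transfer y = (\<chi> p. if p \<in> U1 then y p else if p \<in> U2 then y p - max_below y p else 0)"

lemma transfer_nth_U2: "p \<in> U2 \<Longrightarrow> transfer y $ p = y p - max_below y p"
  using U_disjoint by (auto simp: transfer_def)

lemma transfer_in_space: "transfer y \<in> unmarked_space P A"
  using U_eq by (auto simp: transfer_def unmarked_space_def)

lemma marked_coord_transfer:
  assumes "\<And>a. a \<in> A \<Longrightarrow> y a = lam a" "p \<in> A \<union> U1"
  shows "marked_coord A lam (transfer y) p = y p"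
  using assms by (auto simp: marked_coord_def transfer_def)

text \<open>Each summand is at most the increase of \<open>y\<close> over the step before it, so the
  sum telescopes.\<close>

lemma transfer_chain_sum_le:
  assumes "successively (covers P) (s # ps)" "set ps \<subseteq> U2"
  shows "(\<Sum>p\<leftarrow>ps. transfer y $ p) \<le> y (last (s # ps)) - y s"
  using assms
proof (induction ps rule: rev_induct)
  case (snoc q qs)
  have "successively (covers P) (s # qs)" "covers P (last (s # qs)) q"
    using snoc.prems successively_append_iff[of "covers P" "s # qs" "[q]"] by auto
  moreover have "last (s # qs @ [q]) = q" by simp
  ultimately show ?case using snoc max_below_ge[of "last (s # qs)" q y]
    by (simp add: transfer_nth_U2 del: last.simps)
qed simp

text \<open>Separation makes the predecessor the maximiser in \<open>max_below\<close> at every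
  step, so the telescoping estimate loses nothing.\<close>

lemma transfer_chain_sum_eq:
  assumes "successively (covers P) (s # ps)" "set ps \<subseteq> U2"
    and sep: "\<And>q q' r. q \<in> set (s # ps) \<Longrightarrow> covers P q q' \<Longrightarrow> q' \<in> U2 \<Longrightarrow> covers P r q' \<Longrightarrow>
      r \<noteq> q \<Longrightarrow> y r < y q"
  shows "(\<Sum>p\<leftarrow>ps. transfer y $ p) = y (last (s # ps)) - y s"
  using assms
proof (induction ps rule: rev_induct)
  case (snoc q qs)
  have cov: "successively (covers P) (s # qs)" "covers P (last (s # qs)) q"
    using snoc.prems(1) successively_append_iff[of "covers P" "s # qs" "[q]"] by auto
  have "last (s # qs) \<in> set (s # qs @ [q])" by (cases qs rule: rev_cases) auto
  then have "max_below y q = y (last (s # qs))"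
    using snoc.prems(2) by (intro max_below_eq cov(2) snoc.prems(3)[OF _ cov(2)]) auto
  moreover have "(\<Sum>p\<leftarrow>qs. transfer y $ p) = y (last (s # qs)) - y s"
  proof (rule snoc.IH)
    show "y r < y u" if "u \<in> set (s # qs)" "covers P u q'" "q' \<in> U2" "covers P r q'" "r \<noteq> u" for u q' r
      using snoc.prems(3)[OF _ that(2-5)] that(1) by auto
  qed (use cov snoc.prems in auto)
  moreover have "last (s # qs @ [q]) = q" by simp
  ultimately show ?case using snoc.prems(2) by (simp add: transfer_nth_U2 del: last.simps)
qed simp

text \<open>
  Read both chains backwards from their common last element: where they first separate, \<open>(s', ps')\<close>
  misses the maximum subtracted in \<open>transfer\<close>.
\<close>

lemma transfer_chain_sum_less:
  assumes "successively (covers P) (s # ps)" "set ps \<subseteq> U2" "s \<notin> U2"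
    and "successively (covers P) (s' # ps')" "set ps' \<subseteq> U2" "s' \<notin> U2"
    and "last (s' # ps') = last (s # ps)" "(s', ps') \<noteq> (s, ps)"
    and sep: "\<And>q q' r. q \<in> set (s # ps) \<Longrightarrow> covers P q q' \<Longrightarrow> q' \<in> U2 \<Longrightarrow> covers P r q' \<Longrightarrow>
      r \<noteq> q \<Longrightarrow> y r < y q"
  shows "(\<Sum>p\<leftarrow>ps'. transfer y $ p) < y (last (s' # ps')) - y s'"
  using assms
proof (induction ps' arbitrary: ps rule: rev_induct)
  case Nil
  show ?case
  proof (cases ps rule: rev_cases)
    case Nil
    then show ?thesis using Nil.prems by simp
  next
    \<comment> \<open>Impossible: the common last element would be both \<open>r\<close> in
      \<open>U2\<close> and \<open>s'\<close> outside it.\<close>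
    case (snoc rs r)
    then show ?thesis using Nil.prems by auto
  qed
next
  case (snoc q qs)
  have cov': "successively (covers P) (s' # qs)" "covers P (last (s' # qs)) q"
    using snoc.prems(4) successively_append_iff[of "covers P" "s' # qs" "[q]"] by auto
  have "q \<in> U2" using snoc.prems(5) by simp
  obtain rs where ps: "ps = rs @ [q]"
    using snoc.prems(3,7) \<open>q \<in> U2\<close> by (cases ps rule: rev_cases) auto
  have cov: "successively (covers P) (s # rs)" "covers P (last (s # rs)) q"
    using snoc.prems(1) successively_append_iff[of "covers P" "s # rs" "[q]"] unfolding ps by auto
  have "(\<Sum>p\<leftarrow>qs. transfer y $ p) + y (last (s' # qs)) < y (last (s' # qs)) - y s' + max_below y q"
  proof (cases "last (s' # qs) = last (s # rs)")
    case True
    have "(\<Sum>p\<leftarrow>qs. transfer y $ p) < y (last (s' # qs)) - y s'"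
    proof (rule snoc.IH[of rs])
      show "y r < y u" if "u \<in> set (s # rs)" "covers P u q'" "q' \<in> U2" "covers P r q'" "r \<noteq> u" for u q' r
        using snoc.prems(9)[OF _ that(2-5)] that(1) unfolding ps by auto
    qed (use cov cov' snoc.prems True in \<open>auto simp: ps simp del: last.simps\<close>)
    then show ?thesis using max_below_ge[OF cov'(2), of y] by linarith
  next
    case False
    have "last (s # rs) \<in> set (s # ps)" unfolding ps by (cases rs rule: rev_cases) auto
    then have "y (last (s' # qs)) < y (last (s # rs))"
      using snoc.prems(9)[OF _ cov(2) \<open>q \<in> U2\<close> cov'(2)] False by blast
    moreover have "(\<Sum>p\<leftarrow>qs. transfer y $ p) \<le> y (last (s' # qs)) - y s'"
      using transfer_chain_sum_le[OF cov'(1)] snoc.prems(5) by simp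
    ultimately show ?thesis using max_below_ge[OF cov(2), of y] by linarith
  qed
  moreover have "last (s' # qs @ [q]) = q" by simp
  ultimately show ?case using \<open>q \<in> U2\<close> by (simp add: transfer_nth_U2 del: last.simps)
qed

lemma chainsD:
  assumes "(s, ps, t) \<in> chains"
  shows "s \<in> A \<union> U1" "t \<in> A \<union> U1" "set ps \<subseteq> U2" "successively (covers P) (s # ps)"
    "covers P (last (s # ps)) t" "s \<notin> U2" "t \<notin> U2"
  using assms U2_not_outer successively_append_iff[of "covers P" "s # ps" "[t]"]
  unfolding chains_def by auto

section \<open>Points witnessing irredundancy\<close>

text \<open>Transfer a strictly increasing potential: elements of \<open>U2\<close> exceed
  everything they cover, and the final cover of a chain makes its inequality strict.\<close>

lemma ex_interior_point:
  obtains z where "z \<in> unmarked_space P A" "\<And>i. i \<in> U2 <+> chains \<Longrightarrow> normal i \<bullet> z < bound i"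
proof -
  obtain y where y: "\<And>a. a \<in> A \<Longrightarrow> y a = lam a" "\<And>p q. p \<in> P \<Longrightarrow> q \<in> P \<Longrightarrow> p < q \<Longrightarrow> y p < y q"
    using ex_separating_potential[of "{}"] by auto
  have strict: "y p < y q" if "covers P p q" for p q
    using y(2) that by (auto simp: covers_def)
  show ?thesis
  proof (rule that[OF transfer_in_space[of y]])
    fix i assume "i \<in> U2 <+> chains"
    then show "normal i \<bullet> transfer y < bound i"
    proof (elim PlusE)
      fix p assume "p \<in> U2" "i = Inl p"
      then show ?thesis
        using max_below_less[of p y "y p"] strict U_subset by (auto simp: satisfies_iff transfer_nth_U2 simp del: normal.simps bound.simps)
    next
      fix c assume "c \<in> chains" "i = Inr c"
      then obtain s ps t where c: "(s, ps, t) \<in> chains" "i = Inr (s, ps, t)" by (cases c) auto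
      show ?thesis
        using transfer_chain_sum_le[OF chainsD(4,3)[OF c(1)], of y] strict[OF chainsD(5)[OF c(1)]]
        unfolding c(2) satisfies_iff
        using chainsD(1,2)[OF c(1)] by (simp add: marked_coord_transfer y)
    qed
  qed
qed

text \<open>Zeroing one coordinate of an interior point can only lower chain sums, while the
  right-hand sides involve no coordinate from \<open>U2\<close>.\<close>

lemma ex_facet_point_nonneg:
  assumes "p \<in> U2"
  shows "\<exists>w\<in>unmarked_space P A. normal (Inl p) \<bullet> w = bound (Inl p) \<and>
    (\<forall>j\<in>U2 <+> chains - {Inl p}. normal j \<bullet> w < bound j)"
proof -
  obtain z where z: "z \<in> unmarked_space P A" "\<And>i. i \<in> U2 <+> chains \<Longrightarrow> normal i \<bullet> z < bound i"
    using ex_interior_point by blast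
  define w :: "real ^ 'p::{finite,order}" where "w = (\<chi> q. if q = p then 0 else z $ q)"
  have "0 < z $ p" using z(2)[OF InlI[OF assms]] by (simp add: satisfies_iff del: normal.simps bound.simps)
  have wz: "w $ q \<le> z $ q" for q using \<open>0 < z $ p\<close> by (simp add: w_def)
  have outer: "marked_coord A lam w q = marked_coord A lam z q" if "q \<in> A \<union> U1" for q
    using that U2_not_outer[OF assms] by (auto simp: marked_coord_def w_def)
  have "w \<in> unmarked_space P A" using z(1) by (auto simp: w_def unmarked_space_def)
  moreover have "normal (Inl p) \<bullet> w = bound (Inl p)"
    unfolding satisfies_iff by (simp add: w_def)
  moreover have "normal j \<bullet> w < bound j" if "j \<in> U2 <+> chains - {Inl p}" for j
  proof (cases j)
    case (Inl q)
    then have "0 < z $ q" "q \<noteq> p" using z(2)[of j] that by (auto simp: satisfies_iff simp del: normal.simps bound.simps)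
    then show ?thesis unfolding Inl satisfies_iff by (simp add: w_def)
  next
    case (Inr c)
    obtain s ps t where "c = (s, ps, t)" by (cases c)
    then have c: "(s, ps, t) \<in> chains" "j = Inr (s, ps, t)" using that Inr by auto
    have "(\<Sum>q\<leftarrow>ps. w $ q) \<le> (\<Sum>q\<leftarrow>ps. z $ q)" using wz by (intro sum_list_mono) auto
    then show ?thesis using z(2)[of j] that chainsD(1,2)[OF c(1)]
      unfolding c(2) satisfies_iff by (simp add: outer)
  qed
  ultimately show ?thesis by blast
qed

text \<open>Transfer a tight potential: a rival chain with another final cover is strict at that
  cover, and one with the same final cover is strict where it separates from the given
  chain.\<close>

lemma ex_facet_point_chain:
  assumes c: "(s, ps, t) \<in> chains"
  shows "\<exists>w\<in>unmarked_space P A. normal (Inr (s, ps, t)) \<bullet> w = bound (Inr (s, ps, t)) \<and>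
    (\<forall>j\<in>U2 <+> chains - {Inr (s, ps, t)}. normal j \<bullet> w < bound j)"
proof -
  note ch = chainsD[OF c]
  have sorted: "sorted_wrt (<) (s # ps)" using ch(4) by (rule successively_covers_sorted)
  have "set (s # ps) \<subseteq> P" using ch(1,3) U_subset marked_subset by auto
  then obtain y where y: "\<And>a. a \<in> A \<Longrightarrow> y a = lam a"
    and strict: "\<And>p q. covers P p q \<Longrightarrow> (p, q) \<noteq> (last (s # ps), t) \<Longrightarrow> y p < y q"
    and eq: "y (last (s # ps)) = y t"
    and sep: "\<And>q q' r. q \<in> set (s # ps) \<Longrightarrow> covers P q q' \<Longrightarrow> q' \<noteq> t \<Longrightarrow> covers P r q' \<Longrightarrow>
      r \<noteq> q \<Longrightarrow> y r < y q"
    using ex_tight_potential[OF _ sorted_wrt_less_total[OF sorted] last_in_set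
        sorted_wrt_less_le_last[OF sorted] ch(5)] by blast
  have sep': "y r < y q"
    if "q \<in> set (s # ps)" "covers P q q'" "q' \<in> U2" "covers P r q'" "r \<noteq> q" for q q' r
    using sep[of q q' r] that ch(7) by blast
  have "normal (Inr (s, ps, t)) \<bullet> transfer y = bound (Inr (s, ps, t))"
    unfolding satisfies_iff
    using transfer_chain_sum_eq[OF ch(4,3) sep'] ch(1,2) eq by (simp add: marked_coord_transfer y)
  moreover have "normal j \<bullet> transfer y < bound j" if "j \<in> U2 <+> chains - {Inr (s, ps, t)}" for j
  proof (cases j)
    case (Inl p)
    then have "p \<in> U2" using that by auto
    \<comment> \<open>The one non-strict cover ends in \<open>t\<close>, outside
      \<open>U2\<close>.\<close>
    then have "max_below y p < y p"
      using U_subset ch(7) by (intro max_below_less strict) auto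
    then show ?thesis unfolding Inl satisfies_iff using \<open>p \<in> U2\<close> by (simp add: transfer_nth_U2)
  next
    case (Inr d)
    obtain s' ps' t' where "d = (s', ps', t')" by (cases d)
    then have d: "(s', ps', t') \<in> chains" "j = Inr (s', ps', t')"
      and ne: "(s', ps', t') \<noteq> (s, ps, t)" using that Inr by auto
    note ch' = chainsD[OF d(1)]
    have "(\<Sum>p\<leftarrow>ps'. transfer y $ p) < y t' - y s'"
    proof (cases "(last (s' # ps'), t') = (last (s # ps), t)")
      case True
      then have "(\<Sum>p\<leftarrow>ps'. transfer y $ p) < y (last (s' # ps')) - y s'"
        using ne by (intro transfer_chain_sum_less[OF ch(4,3,6) ch'(4,3,6) _ _ sep']) auto
      then show ?thesis using True eq by (auto simp del: last.simps)
    next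
      case False
      then show ?thesis
        using strict[OF ch'(5)] transfer_chain_sum_le[OF ch'(4,3), of y] by (auto simp del: last.simps)
    qed
    then show ?thesis unfolding d(2) satisfies_iff using ch'(1,2) by (simp add: marked_coord_transfer y)
  qed
  ultimately show ?thesis using transfer_in_space by blast
qed

lemma
  shows aff_dim_chain_order_polytope: "aff_dim (chain_order_polytope P A lam U1 U2) = int (card (P - A))"
    and card_facets_chain_order_polytope:
      "card {F. F facet_of chain_order_polytope P A lam U1 U2} = card U2 + card chains"
proof -
  obtain z where z: "z \<in> unmarked_space P A" "\<And>i. i \<in> U2 <+> chains \<Longrightarrow> normal i \<bullet> z < bound i"
    using ex_interior_point by blast
  have tight: "\<exists>w\<in>unmarked_space P A. normal i \<bullet> w = bound i \<and>
    (\<forall>j\<in>U2 <+> chains - {i}. normal j \<bullet> w < bound j)" if "i \<in> U2 <+> chains" for i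
    using that ex_facet_point_nonneg ex_facet_point_chain by (elim PlusE) auto
  have "affine (unmarked_space P A)"
    by (intro subspace_imp_affine) (auto simp: unmarked_space_def subspace_def)
  note * = this finite_Plus[OF finite finite_chains] z tight chain_order_polytope_eq
  show "aff_dim (chain_order_polytope P A lam U1 U2) = int (card (P - A))"
    using aff_dim_irredundant_halfspaces[OF *] by (simp add: aff_dim_unmarked_space)
  show "card {F. F facet_of chain_order_polytope P A lam U1 U2} = card U2 + card chains"
    using card_facets_irredundant_halfspaces[OF *] by (simp add: card_Plus finite_chains)
qed

section \<open>Counting chains\<close>

definition paths_to :: "'p \<Rightarrow> ('p \<times> 'p list) set" where
  "paths_to q = {(a, ps). a \<in> A \<and> set ps \<subseteq> P - A \<and> successively (covers P) (a # ps @ [q])}"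

lemma card_paths_to: "card (paths_to q) = num_chains_to P A q"
  by (simp add: paths_to_def num_chains_to_def)

lemma path_step:
  "successively (covers P) (a # (ps @ [q]) @ [t]) \<longleftrightarrow>
     successively (covers P) (a # ps @ [q]) \<and> covers P q t"
  using successively_append_iff[of "covers P" "a # ps @ [q]" "[t]"] by auto

lemma covers_U2_source: "covers P p q \<Longrightarrow> q \<in> U2 \<Longrightarrow> p \<notin> A \<Longrightarrow> p \<in> U2"
  using U2_ideal[of q p] by (auto simp: covers_def)

text \<open>A path ending in the ideal \<open>U2\<close> stays in it after its marked start, so the
  paths counted by \<open>num_chains_to\<close> can serve as initial segments of members of
  \<open>chains\<close>.\<close>

lemma paths_to_U2:
  assumes "(a, ps) \<in> paths_to q" "q \<in> U2" shows "set ps \<subseteq> U2"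
proof
  fix p assume p: "p \<in> set ps"
  have "sorted_wrt (<) (a # ps @ [q])"
    using assms by (intro successively_covers_sorted) (auto simp: paths_to_def)
  then have "p < q" using p by (auto simp: sorted_wrt_append)
  then show "p \<in> U2" using U2_ideal[OF assms(2), of p] p assms(1) by (auto simp: paths_to_def)
qed

lemma finite_paths_to: "finite (paths_to q)"
proof (rule finite_subset)
  show "paths_to q \<subseteq> UNIV \<times> {ps. set ps \<subseteq> UNIV \<and> distinct ps}"
  proof (rule subrelI)
    fix a ps assume "(a, ps) \<in> paths_to q"
    then have "sorted_wrt (<) (a # ps @ [q])"
      by (intro successively_covers_sorted) (auto simp: paths_to_def)
    then have "sorted_wrt (<) ps" by (simp add: sorted_wrt_append)
    then show "(a, ps) \<in> UNIV \<times> {ps. set ps \<subseteq> UNIV \<and> distinct ps}"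
      by (simp add: sorted_wrt_less_distinct)
  qed
  show "finite ((UNIV :: 'p set) \<times> {ps :: 'p list. set ps \<subseteq> UNIV \<and> distinct ps})"
    by (intro finite_cartesian_product finite_subset_distinct) auto
qed

text \<open>Paths are sorted by the element just before \<open>q\<close>: the marked start, or an
  unmarked element, which the ideal property puts in \<open>U2\<close>.\<close>

lemma card_paths_to_rec:
  assumes "q \<in> U2"
  shows "card (paths_to q) =
    card {a \<in> A. covers P a q} + (\<Sum>r\<in>{r \<in> U2. covers P r q}. card (paths_to r))"
proof -
  let ?f = "\<lambda>a. (a, [] :: 'p list)" and ?g = "\<lambda>(r :: 'p, a :: 'p, ps). (a, ps @ [r])"
  let ?X = "{a \<in> A. covers P a q}" and ?Y = "Sigma {r \<in> U2. covers P r q} paths_to"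
  have "paths_to q = ?f ` ?X \<union> ?g ` ?Y"
  proof (intro set_eqI iffI)
    fix c assume c: "c \<in> paths_to q"
    obtain a ps where ap: "c = (a, ps)" by (cases c)
    show "c \<in> ?f ` ?X \<union> ?g ` ?Y"
    proof (cases ps rule: rev_cases)
      case Nil
      then show ?thesis using c ap by (auto simp: paths_to_def)
    next
      case (snoc qs r)
      have "r \<in> U2" using paths_to_U2[of a ps q] c ap snoc assms by auto
      then have "(r, a, qs) \<in> ?Y" using c unfolding ap snoc
        by (simp add: paths_to_def path_step[simplified])
      then show ?thesis unfolding ap snoc by force
    qed
  next
    fix c assume "c \<in> ?f ` ?X \<union> ?g ` ?Y"
    then show "c \<in> paths_to q" using U_subset
      by (auto simp: paths_to_def path_step[simplified])
  qed
  moreover have "?f ` ?X \<inter> ?g ` ?Y = {}" by auto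
  moreover have "inj_on ?f ?X" "inj_on ?g ?Y" by (auto simp: inj_on_def)
  moreover have "finite ?Y" by (intro finite_SigmaI finite_paths_to) auto
  ultimately have "card (paths_to q) = card ?X + card ?Y"
    by (simp add: card_Un_disjoint card_image)
  then show ?thesis by (simp add: card_SigmaI finite_paths_to)
qed

text \<open>This controls the truncated subtraction in \<open>star_weight\<close>. At a minimal
  counterexample the recursion forbids marked lower covers, so a lower cover is a smaller
  counterexample.\<close>

lemma card_paths_to_pos:
  assumes "q \<in> U2" shows "0 < card (paths_to q)"
proof (rule ccontr)
  let ?Z = "{p \<in> U2. card (paths_to p) = 0}"
  assume "\<not> 0 < card (paths_to q)"
  then have "q \<in> ?Z" using assms by simp
  then have "\<exists>m\<in>?Z. m \<le> q \<and> (\<forall>b\<in>?Z. b \<le> m \<longrightarrow> m = b)"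
    by (rule finite_has_minimal2[OF finite])
  then obtain m where m: "m \<in> ?Z" and min: "\<forall>b\<in>?Z. b \<le> m \<longrightarrow> m = b" by (elim bexE conjE)
  have "m \<in> P - A" using m U_subset by blast
  then obtain r where r: "covers P r m" using ex_covered by blast
  have "card {a \<in> A. covers P a m} + (\<Sum>r\<in>{r \<in> U2. covers P r m}. card (paths_to r)) = 0"
    using card_paths_to_rec[of m] m by (simp only: mem_Collect_eq)
  then have "{a \<in> A. covers P a m} = {}" "\<forall>r\<in>{r \<in> U2. covers P r m}. card (paths_to r) = 0"
    unfolding add_is_0 card_0_eq[OF finite] sum_eq_0_iff[OF finite] by (rule conjunct1, rule conjunct2)
  then have "r \<in> ?Z" using covers_U2_source[OF r] r m by blast
  moreover have "r < m" using r by (simp add: covers_def)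
  ultimately have "m = r" using min less_imp_le by blast
  then show False using \<open>r < m\<close> by simp
qed

text \<open>This is for the other factor of \<open>star_weight\<close>: some mark lies strictly
  above \<open>q\<close>, and a minimal element strictly above \<open>q\<close> covers it.\<close>

lemma num_covering_pos:
  assumes "q \<in> U2" shows "0 < num_covering P q"
proof -
  have q: "q \<in> P" "q \<notin> A" using assms U_subset by auto
  then obtain b where b: "b \<in> A" "q \<le> b" using ex_marked_above by blast
  then have "b \<in> {p \<in> P. q < p}" using q marked_subset by (auto simp: order.order_iff_strict)
  then have "\<exists>r\<in>{p \<in> P. q < p}. r \<le> b \<and> (\<forall>c\<in>{p \<in> P. q < p}. c \<le> r \<longrightarrow> r = c)"
    by (rule finite_has_minimal2[OF finite])
  then obtain r where r: "r \<in> {p \<in> P. q < p}" "\<forall>c\<in>{p \<in> P. q < p}. c \<le> r \<longrightarrow> r = c"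
    by (elim bexE conjE)
  have "\<not> (q < c \<and> c < r)" if "c \<in> P" for c
  proof
    assume "q < c \<and> c < r"
    then have "r = c" using r(2) that less_imp_le by blast
    then show False using \<open>q < c \<and> c < r\<close> by simp
  qed
  then have "covers P q r" using q(1) r(1) by (simp add: covers_def)
  then have "r \<in> {p \<in> P. covers P q p}" using r(1) by blast
  then show ?thesis unfolding num_covering_def by (subst card_gt_0_iff) auto
qed

section \<open>Double counting chains and covers\<close>

definition outer_covers :: "('p \<times> 'p) set" where
  "outer_covers = {(s, t). s \<in> A \<union> U1 \<and> t \<in> A \<union> U1 \<and> covers P s t}"

text \<open>A chain with empty list is a cover between outer elements; any other is cut at its last
  element \<open>q\<close> in \<open>U2\<close> into a path to \<open>q\<close> and a cover leaving
  \<open>U2\<close>.\<close>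

lemma card_chains:
  "card chains = card outer_covers +
     (\<Sum>q\<in>U2. card (paths_to q) * card {t \<in> A \<union> U1. covers P q t})"
proof -
  let ?f = "\<lambda>(s :: 'p, t :: 'p). (s, [] :: 'p list, t)"
    and ?g = "\<lambda>(q :: 'p, (a :: 'p, ps), t :: 'p). (a, ps @ [q], t)"
  let ?Y = "Sigma U2 (\<lambda>q. paths_to q \<times> {t \<in> A \<union> U1. covers P q t})"
  have "chains = ?f ` outer_covers \<union> ?g ` ?Y"
  proof (intro set_eqI iffI)
    fix c assume c: "c \<in> chains"
    obtain s ps t where ap: "c = (s, ps, t)" by (cases c)
    show "c \<in> ?f ` outer_covers \<union> ?g ` ?Y"
    proof (cases ps rule: rev_cases)
      case Nil
      then show ?thesis using c ap by (auto simp: chains_def outer_covers_def)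
    next
      case (snoc qs r)
      \<comment> \<open>The start is marked: an unmarked element covered by one in \<open>U2\<close>
        would itself lie in the ideal.\<close>
      have "hd ps \<in> U2" "covers P s (hd ps)"
        using c ap snoc by (auto simp: chains_def successively_Cons hd_append split: if_splits)
      then have "s \<in> A" using covers_U2_source U2_not_outer c ap by (auto simp: chains_def)
      then have "(r, (s, qs), t) \<in> ?Y" using c U_subset unfolding ap snoc
        by (auto simp: paths_to_def chains_def path_step[simplified])
      then show ?thesis unfolding ap snoc by force
    qed
  next
    fix c assume "c \<in> ?f ` outer_covers \<union> ?g ` ?Y"
    then show "c \<in> chains"
    proof
      assume "c \<in> ?f ` outer_covers"
      then show ?thesis by (auto simp: outer_covers_def chains_def)
    next
      assume "c \<in> ?g ` ?Y"
      then obtain q a ps t where *: "c = (a, ps @ [q], t)" "q \<in> U2" "(a, ps) \<in> paths_to q"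
        "t \<in> A \<union> U1" "covers P q t" by auto
      then show ?thesis using paths_to_U2[of a ps q]
        by (auto simp: chains_def paths_to_def path_step[simplified])
    qed
  qed
  moreover have "?f ` outer_covers \<inter> ?g ` ?Y = {}" by auto
  moreover have "inj_on ?f outer_covers" "inj_on ?g ?Y" by (auto simp: inj_on_def)
  moreover have "finite ?Y" by (intro finite_SigmaI finite_cartesian_product finite_paths_to) auto
  ultimately have "card chains = card outer_covers + card ?Y"
    by (simp add: card_Un_disjoint card_image)
  then show ?thesis by (simp add: card_SigmaI finite_paths_to card_cartesian_product)
qed

text \<open>Covers meeting \<open>U2\<close> either start in \<open>U2\<close> or enter it from
  outside; in the latter case the ideal property forces a marked start.\<close>

lemma card_covers:
  "card {(p, q). covers P p q} = card outer_covers +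
     (\<Sum>q\<in>U2. num_covering P q) + (\<Sum>q\<in>U2. card {a \<in> A. covers P a q})"
proof -
  let ?X = "Sigma U2 (\<lambda>q. {p \<in> P. covers P q p})" and ?Y = "Sigma U2 (\<lambda>q. {a \<in> A. covers P a q})"
  have "{(p, q). covers P p q} = outer_covers \<union> (?X \<union> prod.swap ` ?Y)"
    (is "?L = ?R")
  proof (intro set_eqI iffI)
    fix e assume "e \<in> ?L"
    then obtain p q where e: "e = (p, q)" "covers P p q" by auto
    then have "p \<in> A \<union> U1 \<union> U2" "q \<in> A \<union> U1 \<union> U2" "q \<in> P" using U_eq by (auto simp: covers_def)
    then show "e \<in> ?R"
      using e covers_U2_source[of p q] by (auto simp: outer_covers_def image_iff)
  qed (auto simp: outer_covers_def)
  moreover have "outer_covers \<inter> (?X \<union> prod.swap ` ?Y) = {}"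
    using U2_not_outer by (auto simp: outer_covers_def)
  moreover have "?X \<inter> prod.swap ` ?Y = {}" using U2_not_outer by auto
  ultimately have "card ?L = card outer_covers + (card ?X + card ?Y)"
    by (simp add: card_Un_disjoint card_image)
  then show ?thesis by (simp add: card_SigmaI num_covering_def)
qed

text \<open>Summing the path recursion over \<open>U2\<close> counts each path to \<open>r\<close>
  once per cover of \<open>r\<close> inside \<open>U2\<close>. Expanding
  \<open>(c q - 1) * (num_covering P q - 1)\<close> then matches chains with covers.\<close>

lemma card_inequalities:
  "card U2 + card chains =
     card {(p, q). covers P p q} + (\<Sum>q\<in>U2 \<inter> star_elements P A. star_weight P A q)"
proof -
  define c where "c q = int (card (paths_to q))" for q
  define inner where "inner q = {t \<in> U2. covers P q t}" for q
  define outer where "outer q = {t \<in> A \<union> U1. covers P q t}" for q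
  have u: "int (num_covering P q) = int (card (inner q)) + int (card (outer q))" for q
  proof -
    have "{p \<in> P. covers P q p} = inner q \<union> outer q"
      using U_eq marked_subset by (auto simp: inner_def outer_def)
    moreover have "inner q \<inter> outer q = {}" using U2_not_outer by (auto simp: inner_def outer_def)
    ultimately show ?thesis by (simp add: num_covering_def card_Un_disjoint)
  qed
  have "(\<Sum>q\<in>U2. \<Sum>r\<in>{r \<in> U2. covers P r q}. c r) = (\<Sum>r\<in>U2. \<Sum>q\<in>inner r. c r)"
    unfolding inner_def by (rule sum.swap_restrict) auto
  also have "\<dots> = (\<Sum>r\<in>U2. c r * int (card (inner r)))" by (simp add: mult.commute)
  finally have swap: "(\<Sum>q\<in>U2. \<Sum>r\<in>{r \<in> U2. covers P r q}. c r) =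
      (\<Sum>r\<in>U2. c r * int (card (inner r)))" .
  have sum_c: "(\<Sum>q\<in>U2. c q) =
      (\<Sum>q\<in>U2. int (card {a \<in> A. covers P a q})) + (\<Sum>r\<in>U2. c r * int (card (inner r)))"
  proof -
    have "(\<Sum>q\<in>U2. c q) = (\<Sum>q\<in>U2. int (card {a \<in> A. covers P a q}) +
        (\<Sum>r\<in>{r \<in> U2. covers P r q}. c r))"
      unfolding c_def
    proof (rule sum.cong[OF refl])
      fix q assume "q \<in> U2"
      show "int (card (paths_to q)) = int (card {a \<in> A. covers P a q}) +
          (\<Sum>r\<in>{r \<in> U2. covers P r q}. int (card (paths_to r)))"
        by (subst card_paths_to_rec[OF \<open>q \<in> U2\<close>]) simp
    qed
    then show ?thesis using swap by (simp add: sum.distrib)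
  qed
  have weight: "int (star_weight P A q) = (c q - 1) * (int (num_covering P q) - 1)" if "q \<in> U2" for q
    using num_covering_pos[OF that] card_paths_to_pos[OF that]
    by (simp add: star_weight_def c_def card_paths_to of_nat_diff)
  \<comment> \<open>For an element of \<open>U2\<close> that is not a star element, one factor of
    the weight is 0.\<close>
  have "(\<Sum>q\<in>U2 \<inter> star_elements P A. star_weight P A q) = (\<Sum>q\<in>U2. star_weight P A q)"
  proof (rule sum.mono_neutral_left)
    show "\<forall>q\<in>U2 - U2 \<inter> star_elements P A. star_weight P A q = 0"
      using U_subset by (auto simp: star_elements_def star_weight_def not_le less_Suc_eq numeral_2_eq_2)
  qed auto
  then have "int (\<Sum>q\<in>U2 \<inter> star_elements P A. star_weight P A q) =
      (\<Sum>q\<in>U2. (c q - 1) * (int (num_covering P q) - 1))"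
    by (simp add: weight)
  also have "\<dots> = (\<Sum>q\<in>U2. c q * int (card (inner q))) + (\<Sum>q\<in>U2. c q * int (card (outer q)))
      - (\<Sum>q\<in>U2. c q) - (\<Sum>q\<in>U2. int (num_covering P q)) + int (card U2)"
    unfolding u by (simp add: algebra_simps sum.distrib sum_subtractf)
  finally have "int (card U2 + card chains) =
     int (card {(p, q). covers P p q} + (\<Sum>q\<in>U2 \<inter> star_elements P A. star_weight P A q))"
    using sum_c unfolding card_chains card_covers c_def outer_def by simp
  then show ?thesis by (simp only: of_nat_eq_iff)
qed

text \<open>Nonemptiness rules out facet dimension -1, where \<open>face_number\<close> would count
  the empty face, which \<open>facet_of\<close> excludes.\<close>

lemma face_number_chain_order_polytope:
  assumes "P - A \<noteq> {}"
  shows "face_number (int (card (P - A)) - 1) (chain_order_polytope P A lam U1 U2) =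
    card {(p, q). covers P p q} + (\<Sum>q\<in>U2 \<inter> star_elements P A. star_weight P A q)"
proof -
  have "0 < card (P - A)" using assms by (simp only: card_gt_0_iff finite simp_thms)
  from face_number_eq_card_facets[OF aff_dim_chain_order_polytope this] show ?thesis
    by (simp only: card_facets_chain_order_polytope card_inequalities)
qed

end

section \<open>Comparison with the order polytope\<close>

theorem proposition4p1:
  fixes P A :: "'p::{finite,order} set" and lam :: "'p \<Rightarrow> real" and N :: nat
  assumes "marked_poset P A lam"
    and "regular_marking P A lam"
    and "N = card (P - A)"
  shows "(\<forall>U1 U2. admissible_decomposition P A U1 U2 \<longrightarrow>
            face_number (int N - 1) (chain_order_polytope P A lam U1 U2) =
            face_number (int N - 1) (order_polytope P A lam) +
              (\<Sum>q\<in>U2 \<inter> star_elements P A. star_weight P A q)) \<and>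
         (\<forall>U1 U2 U1' U2'.
            admissible_decomposition P A U1 U2 \<and> admissible_decomposition P A U1' U2' \<longrightarrow>
            int (face_number (int N - 1) (chain_order_polytope P A lam U1 U2)) -
            int (face_number (int N - 1) (chain_order_polytope P A lam U1' U2')) =
            int (\<Sum>q\<in>U2 \<inter> star_elements P A. star_weight P A q) -
            int (\<Sum>q\<in>U2' \<inter> star_elements P A. star_weight P A q))"
proof -
  have main: "face_number (int N - 1) (chain_order_polytope P A lam U1 U2) =
      face_number (int N - 1) (order_polytope P A lam) +
        (\<Sum>q\<in>U2 \<inter> star_elements P A. star_weight P A q)"
    if adm: "admissible_decomposition P A U1 U2" for U1 U2
  proof (cases "P - A = {}")
    \<comment> \<open>With no unmarked elements both parts are empty and the two polytopes
      coincide.\<close>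
    case True
    then have "U1 = {}" "U2 = {}" using adm by (auto simp: admissible_decomposition_def)
    then show ?thesis
      by (simp only: order_polytope_def True Int_empty_left sum.empty add_0_right)
  next
    case False
    interpret CO: decomposed_marked_poset P A lam U1 U2
      by unfold_locales (fact assms adm)+
    \<comment> \<open>The order polytope is the case of an empty chain part, so its facets are as
      many as the cover relations.\<close>
    interpret O: decomposed_marked_poset P A lam "P - A" "{}"
      by unfold_locales (simp add: admissible_decomposition_def)
    show ?thesis
      using CO.face_number_chain_order_polytope[OF False] O.face_number_chain_order_polytope[OF False]
      by (simp only: order_polytope_def assms(3) Int_empty_left sum.empty add_0_right)
  qed
  then show ?thesis by auto
qed

end
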